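(* Let $n\ge1$, let $\phi^1,\dots,\phi^m$ be essentially bounded functions on $[0,1]^n$ and let $\eta^1,\dots,\eta^m\in\mathbb R$. Let $\mathcal F$ be the set of monotone functions from $[0,1]^n$ to $[0,1]$ and $$\overline{\mathcal F}:=\Big\{f\in\mathcal F:\ \int_{[0,1]^n} f(x)\phi^j(x)\,dx\le\eta^j\ \text{ for all } j\in\{1,\dots,m\}\Big\}.$$ Then every extreme point of $\overline{\mathcal F}$ is a mixture (convex combination) of at most $m+1$ indicator functions $\{\mathbf 1_{A_j}\}_{j=1}^{m+1}$, where $\{A_j\}_{j=1}^{m+1}$ are nested up-sets.
   Context: The order on $[0,1]^n$ is component-wise; $f$ is monotone if $x\le y$ implies $f(x)\le f(y)$. $\mathcal F$ is viewed as a subset of $L^1([0,1]^n)$ (Lebesgue measure), so functions equal almost everywhere are identified. A set $A\subseteq[0,1]^n$ is an up-set if $x\in A$, $y\ge x$ imply $y\in A$. A family of up-sets $\{A_j\}$ is nested if $A_j\subseteq A_{j'}$ for all $j<j'$. *)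

theory Defs
  imports "HOL-Analysis.Analysis"
begin

abbreviation cube_measure :: "(real^'n) measure" where
  "cube_measure \<equiv> lebesgue_on {0..1}"

definition L1_eq :: "(real^'n \<Rightarrow> real) \<Rightarrow> (real^'n \<Rightarrow> real) \<Rightarrow> bool" where
  "L1_eq f g \<longleftrightarrow> integrable cube_measure f \<and> integrable cube_measure g
     \<and> (AE x in cube_measure. f x = g x)"

lemma L1_eq_part_equivp: "part_equivp L1_eq"
proof (rule part_equivpI)
  show "\<exists>f. L1_eq f f"
    by (rule exI[of _ "\<lambda>_. 0"]) (simp add: L1_eq_def)
  show "symp L1_eq"
    by (rule sympI) (auto simp: L1_eq_def elim: eventually_mono)
  show "transp L1_eq"
    by (rule transpI) (auto simp: L1_eq_def elim: eventually_elim2)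
qed

text \<open>Only the linear structure of \<open>L\<^sup>1\<close> is set up: the notion of an extreme point does not involve
  the norm.\<close>

quotient_type 'n cube_L1 = "real^'n \<Rightarrow> real" / partial: L1_eq
  morphisms rep_L1 L1_of
  by (rule L1_eq_part_equivp)

instantiation cube_L1 :: (finite) real_vector
begin

lift_definition zero_cube_L1 :: "'a cube_L1" is "\<lambda>_. 0"
  by (simp add: L1_eq_def)

lift_definition plus_cube_L1 :: "'a cube_L1 \<Rightarrow> 'a cube_L1 \<Rightarrow> 'a cube_L1"
  is "\<lambda>f g x. f x + g x"
  by (simp add: L1_eq_def) (elim conjE, erule (1) eventually_elim2, simp)

lift_definition uminus_cube_L1 :: "'a cube_L1 \<Rightarrow> 'a cube_L1"
  is "\<lambda>f x. - f x"
  by (auto simp: L1_eq_def)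

lift_definition minus_cube_L1 :: "'a cube_L1 \<Rightarrow> 'a cube_L1 \<Rightarrow> 'a cube_L1"
  is "\<lambda>f g x. f x - g x"
  by (simp add: L1_eq_def) (elim conjE, erule (1) eventually_elim2, simp)

lift_definition scaleR_cube_L1 :: "real \<Rightarrow> 'a cube_L1 \<Rightarrow> 'a cube_L1"
  is "\<lambda>c f x. c * f x"
  by (auto simp: L1_eq_def)

instance
  by standard (transfer, simp add: L1_eq_def algebra_simps)+

end

definition monotone_fns :: "(real^'n \<Rightarrow> real) set" where
  "monotone_fns = {f. mono_on {0..1} f \<and> f \<in> {0..1} \<rightarrow> {0..1}}"

definition constrained_fns ::
  "nat \<Rightarrow> (nat \<Rightarrow> real^'n \<Rightarrow> real) \<Rightarrow> (nat \<Rightarrow> real) \<Rightarrow> (real^'n \<Rightarrow> real) set" where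
  "constrained_fns m \<phi> \<eta> =
     {f \<in> monotone_fns. \<forall>j\<in>{1..m}. (\<integral>x. f x * \<phi> j x \<partial>cube_measure) \<le> \<eta> j}"

definition ess_bounded :: "(real^'n \<Rightarrow> real) \<Rightarrow> bool" where
  "ess_bounded \<phi> \<longleftrightarrow> \<phi> \<in> borel_measurable cube_measure
     \<and> (\<exists>C. AE x in cube_measure. \<bar>\<phi> x\<bar> \<le> C)"

definition up_set :: "(real^'n) set \<Rightarrow> bool" where
  "up_set A \<longleftrightarrow> A \<subseteq> {0..1} \<and> (\<forall>x\<in>A. \<forall>y\<in>{0..1}. x \<le> y \<longrightarrow> y \<in> A)"

text \<open>Up-sets and monotone functions need not be Borel, but they are always Lebesgue measurable;
  hence \<^const>\<open>L1_of\<close> is only applied to integrable functions below.\<close>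

lemma up_set_lebesgue:
  fixes A :: "(real^'n) set"
  assumes "up_set A"
  shows "A \<in> sets lebesgue"
proof -
  define U where "U = {y::real^'n. \<exists>x\<in>A. x \<le> y}"
  have AU: "A = U \<inter> {0..1}"
    using assms unfolding up_set_def U_def by auto
  have int: "y \<in> interior U" if x: "x \<in> closure U" and lt: "\<And>i. x $ i < y $ i" for x y :: "real^'n"
  proof -
    have "open {z::real^'n. \<forall>i\<in>UNIV. z $ i < y $ i}"
      unfolding Collect_ball_eq
      by (intro open_INT ballI open_Collect_less continuous_intros) auto
    moreover have "x \<in> {z. \<forall>i\<in>UNIV. z $ i < y $ i}"
      using lt by simp
    ultimately have "U \<inter> {z. \<forall>i\<in>UNIV. z $ i < y $ i} \<noteq> {}"
      using x open_Int_closure_eq_empty[of "{z. \<forall>i\<in>UNIV. z $ i < y $ i}" U]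
      by (simp add: Int_commute disjoint_iff) metis
    then obtain z where z: "z \<in> U" "\<And>i. z $ i < y $ i"
      by auto
    have o: "open {w::real^'n. \<forall>i\<in>UNIV. z $ i < w $ i}"
      unfolding Collect_ball_eq
      by (intro open_INT ballI open_Collect_less continuous_intros) auto
    obtain a where a: "a \<in> A" "a \<le> z"
      using z(1) unfolding U_def by blast
    have "{w::real^'n. \<forall>i\<in>UNIV. z $ i < w $ i} \<subseteq> U"
    proof
      fix w assume "w \<in> {w::real^'n. \<forall>i\<in>UNIV. z $ i < w $ i}"
      then have "z \<le> w" by (auto simp: less_eq_vec_def less_imp_le)
      with a show "w \<in> U" unfolding U_def by (blast intro: order_trans)
    qed
    then show ?thesis
      using o z(2) by (intro interiorI[OF o]) auto
  qed
  have neg: "negligible (frontier U \<inter> {0..1})"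
  proof (rule starlike_negligible[of _ "-1"])
    show "closed (frontier U \<inter> {0..1::real^'n})"
      by (intro closed_Int frontier_closed closed_cbox) (simp add: closed_eucl_atLeastAtMost)
    fix c :: real and x :: "real^'n"
    assume 1: "-1 + c *\<^sub>R x \<in> frontier U \<inter> {0..1}" and c: "0 \<le> c"
      and 2: "-1 + x \<in> frontier U \<inter> {0..1}"
    have x1: "1 \<le> x $ i" for i
      using 2 by (auto simp: less_eq_vec_def)
    have cx1: "1 \<le> c * x $ i" for i
      using 1 by (auto simp: less_eq_vec_def)
    have "\<not> c < 1"
    proof
      assume "c < 1"
      then have "c * x $ i < x $ i" for i using x1[of i] by simp
      then have "-1 + x \<in> interior U"
        using 1 by (intro int[of "-1 + c *\<^sub>R x"]) (auto simp: frontier_def)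
      with 2 show False by (simp add: frontier_def)
    qed
    moreover have "\<not> c > 1"
    proof
      assume "c > 1"
      then have "x $ i < c * x $ i" for i using x1[of i] by simp
      then have "-1 + c *\<^sub>R x \<in> interior U"
        using 2 by (intro int[of "-1 + x"]) (auto simp: frontier_def)
      with 1 show False by (simp add: frontier_def)
    qed
    ultimately show "c = 1" by simp
  qed
  have "interior U \<subseteq> U" "U \<subseteq> closure U"
    by (simp_all add: interior_subset closure_subset)
  then have "A = (interior U \<inter> {0..1}) \<union> (A \<inter> (frontier U \<inter> {0..1}))"
    unfolding AU frontier_def by blast
  moreover have "A \<inter> (frontier U \<inter> {0..1}) \<in> sets lebesgue"
    using neg negligible_imp_sets negligible_subset by (metis inf_le2)
  moreover have "interior U \<inter> {0..1} \<in> sets lebesgue"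
    by (intro sets.Int) (auto simp: borel_closed closed_eucl_atLeastAtMost)
  ultimately show ?thesis
    by (metis sets.Un)
qed

lemma monotone_fns_integrable:
  fixes f :: "real^'n \<Rightarrow> real"
  assumes "f \<in> monotone_fns"
  shows "integrable cube_measure f"
proof -
  have cube: "{0..1::real^'n} \<in> lmeasurable"
    by (simp add: interval_cbox)
  have "{x \<in> {0..1}. a \<le> f x} \<in> sets lebesgue" for a
  proof (rule up_set_lebesgue)
    show "up_set {x \<in> {0..1}. a \<le> f x}"
      using assms unfolding up_set_def monotone_fns_def mono_on_def
      by (auto intro: order_trans)
  qed
  then have "f \<in> borel_measurable cube_measure"
    using cube unfolding borel_measurable_iff_ge
    by (auto simp: sets_restrict_space_iff space_restrict_space fmeasurableD)
  moreover have "finite_measure (cube_measure :: (real^'n) measure)"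
    using cube by (intro finite_measureI) (auto simp: emeasure_restrict_space fmeasurable_def less_top)
  moreover have "AE x in cube_measure. norm (f x) \<le> 1"
    using assms by (intro AE_I2) (auto simp: monotone_fns_def Pi_iff)
  ultimately show ?thesis
    by (intro finite_measure.integrable_const_bound)
qed

lemma up_set_indicator_monotone:
  "up_set A \<Longrightarrow> indicat_real A \<in> monotone_fns"
  by (auto simp: up_set_def monotone_fns_def mono_on_def indicator_def)

end

theory Submission
  imports Defs
begin

text \<open>
  If \<open>h\<close> is 1-Lipschitz on \<open>[0,1]\<close> and vanishes at both ends, then \<open>f \<plusminus> h \<circ> f\<close> are again monotone
  functions into \<open>[0,1]\<close>.  Hence, if \<open>f\<close> is extreme and \<open>h \<circ> f\<close> is orthogonal to every \<open>\<phi> j\<close>, then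
  \<open>h \<circ> f\<close> vanishes almost everywhere.  If the essential range of \<open>f\<close> had \<open>m + 1\<close> points inside
  \<open>(0,1)\<close>, some nontrivial combination \<open>h\<close> of \<open>m + 1\<close> disjoint tent functions around these points
  would satisfy the \<open>m\<close> orthogonality conditions, a contradiction.  So \<open>f\<close> takes almost everywhere
  values in \<open>{0, 1}\<close> and at most \<open>m\<close> further points, and it is the mixture of the indicators of its
  superlevel sets at the nonzero values, weighted by the gaps between consecutive values.
\<close>

section \<open>Homogeneous linear systems\<close>

text \<open>Gaussian elimination, by induction on the equations: a new equation either vanishes on
  \<open>I\<close> or determines one unknown \<open>p\<close>, which is then eliminated from the
  others.\<close>

lemma underdetermined_system_nontrivial_solution:
  fixes a :: "'j \<Rightarrow> 'i \<Rightarrow> 'a::field"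
  assumes "finite J" "finite I" "card J < card I"
  shows "\<exists>c. (\<exists>i\<in>I. c i \<noteq> 0) \<and> (\<forall>j\<in>J. (\<Sum>i\<in>I. c i * a j i) = 0)"
  using assms
proof (induction J arbitrary: a I rule: finite_induct)
  case empty
  then obtain i where "i \<in> I" by fastforce
  then show ?case by (intro exI[of _ "\<lambda>_. 1"]) auto
next
  case (insert k J)
  show ?case
  proof (cases "\<forall>i\<in>I. a k i = 0")
    case True
    moreover have "card J < card I" using insert.prems insert.hyps by simp
    with insert.IH[of I a] insert.prems
    obtain c where "\<exists>i\<in>I. c i \<noteq> 0" "\<forall>j\<in>J. (\<Sum>i\<in>I. c i * a j i) = 0" by blast
    ultimately show ?thesis by (intro exI[of _ c]) simp
  next
    case False
    then obtain p where p: "p \<in> I" "a k p \<noteq> 0" by blast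
    let ?I = "I - {p}"
    have "card J < card ?I"
      using insert.prems insert.hyps p by simp
    \<comment> \<open>Subtracting \<open>a j p / a k p\<close> times equation \<open>k\<close> from
      equation \<open>j\<close> cancels the unknown \<open>p\<close>.\<close>
    with insert.IH[of ?I "\<lambda>j i. a j i - a j p * a k i / a k p"] insert.prems
    obtain c where c: "\<exists>i\<in>?I. c i \<noteq> 0"
      and c0: "\<And>j. j \<in> J \<Longrightarrow> (\<Sum>i\<in>?I. c i * (a j i - a j p * a k i / a k p)) = 0"
      by auto
    \<comment> \<open>Back-substitution: the value at \<open>p\<close> is the one that equation
      \<open>k\<close> forces.\<close>
    define d where "d = c(p := - (\<Sum>i\<in>?I. c i * a k i) / a k p)"
    have sum_d: "(\<Sum>i\<in>I. d i * a j i) = d p * a j p + (\<Sum>i\<in>?I. c i * a j i)" for j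
      using insert.prems p by (subst sum.remove[of I p]) (auto simp: d_def intro!: sum.cong)
    have "(\<Sum>i\<in>I. d i * a j i) = 0" if "j \<in> insert k J" for j
    proof (cases "j = k")
      case True
      then show ?thesis using p unfolding sum_d by (simp add: d_def)
    next
      case False
      with that have "(\<Sum>i\<in>?I. c i * (a j i - a j p * a k i / a k p)) = 0"
        using c0 by blast
      moreover have "c i * (a j i - a j p * a k i / a k p)
          = c i * a j i - a j p / a k p * (c i * a k i)" for i
        by (simp add: algebra_simps)
      ultimately have "(\<Sum>i\<in>?I. c i * a j i) - a j p / a k p * (\<Sum>i\<in>?I. c i * a k i) = 0"
        by (simp only: sum_subtractf sum_distrib_left)
      then show ?thesis unfolding sum_d by (simp add: d_def algebra_simps)
    qed
    moreover have "\<exists>i\<in>I. d i \<noteq> 0" using c by (auto simp: d_def)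
    ultimately show ?thesis by blast
  qed
qed

section \<open>Computing with \<open>L1_of\<close>\<close>

lemma L1_of_eq_iff:
  assumes "integrable cube_measure f" "integrable cube_measure g"
  shows "L1_of f = L1_of g \<longleftrightarrow> (AE x in cube_measure. f x = g x)"
  using assms Quotient3_rel[OF Quotient3_cube_L1, of f g] by (auto simp: L1_eq_def)

lemma L1_of_sum:
  assumes "finite I" "\<And>i. i \<in> I \<Longrightarrow> integrable cube_measure (g i)"
  shows "(\<Sum>i\<in>I. c i *\<^sub>R L1_of (g i)) = L1_of (\<lambda>x. \<Sum>i\<in>I. c i * g i x)"
  using assms
proof (induction I rule: finite_induct)
  case empty
  then show ?case by (simp add: zero_cube_L1_def)
next
  case (insert i I)
  then show ?case
    by (simp add: plus_cube_L1.abs_eq scaleR_cube_L1.abs_eq L1_eq_def)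
qed

section \<open>Perturbing an extreme point\<close>

text \<open>\<open>h\<close> cannot fall faster than its argument rises, so order survives;
  comparison with the zeros of \<open>h\<close> at 0 and 1 keeps the values in range.\<close>

lemma monotone_fns_perturb:
  fixes f :: "real^'n \<Rightarrow> real"
  assumes f: "f \<in> monotone_fns" and h: "1-lipschitz_on {0..1} h" "h 0 = 0" "h 1 = 0"
  shows "(\<lambda>x. f x + h (f x)) \<in> monotone_fns"
proof -
  have L: "\<bar>h s - h t\<bar> \<le> \<bar>s - t\<bar>" if "s \<in> {0..1}" "t \<in> {0..1}" for s t
    using lipschitz_onD[OF h(1) that] by (simp add: dist_real_def)
  have 1: "f x + h (f x) \<le> f y + h (f y)" if "x \<in> {0..1}" "y \<in> {0..1}" "x \<le> y" for x y
  proof -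
    have "f x \<le> f y" "f x \<in> {0..1}" "f y \<in> {0..1}"
      using f that by (auto simp: monotone_fns_def mono_on_def)
    with L[of "f x" "f y"] show ?thesis by auto
  qed
  have 2: "f x + h (f x) \<in> {0..1}" if "x \<in> {0..1}" for x
  proof -
    have fx: "f x \<in> {0..1}" using f that by (auto simp: monotone_fns_def)
    with L[of "f x" 0] L[of "f x" 1] h(2,3) show ?thesis by auto
  qed
  show ?thesis using 1 2 by (auto simp: monotone_fns_def mono_on_def)
qed

lemma integrable_mult_ess_bounded:
  fixes f :: "real^'n \<Rightarrow> real"
  assumes "integrable cube_measure f" "ess_bounded \<phi>"
  shows "integrable cube_measure (\<lambda>x. f x * \<phi> x)"
proof -
  obtain C where C: "AE x in cube_measure. \<bar>\<phi> x\<bar> \<le> C"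
    and [measurable]: "\<phi> \<in> borel_measurable cube_measure"
    using assms(2) by (auto simp: ess_bounded_def)
  have [measurable]: "f \<in> borel_measurable cube_measure" using assms(1) by simp
  show ?thesis
  proof (rule Bochner_Integration.integrable_bound)
    show "integrable cube_measure (\<lambda>x. f x * C)" using assms(1) by simp
    show "AE x in cube_measure. norm (f x * \<phi> x) \<le> norm (f x * C)"
      using C by eventually_elim (auto simp: abs_mult intro!: mult_left_mono)
  qed measurable
qed

text \<open>Orthogonality gives \<open>p\<close> and \<open>q\<close> the same constraint integrals
  as \<open>f\<close>. Their midpoint is \<open>f\<close>, so extremality forces them to coincide
  almost everywhere.\<close>

lemma extreme_point_perturbation_trivial:
  fixes f :: "real^'n \<Rightarrow> real"
  assumes \<phi>: "\<And>j. j \<in> {1..m} \<Longrightarrow> ess_bounded (\<phi> j)"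
    and f: "f \<in> constrained_fns m \<phi> \<eta>"
    and ext: "L1_of f extreme_point_of (L1_of ` constrained_fns m \<phi> \<eta>)"
    and h: "1-lipschitz_on {0..1} h" "h 0 = 0" "h 1 = 0"
    and orth: "\<And>j. j \<in> {1..m} \<Longrightarrow> (\<integral>x. h (f x) * \<phi> j x \<partial>cube_measure) = 0"
  shows "AE x in cube_measure. h (f x) = 0"
proof (rule ccontr)
  assume nz: "\<not> ?thesis"
  have mf: "f \<in> monotone_fns"
    and cf: "\<And>j. j \<in> {1..m} \<Longrightarrow> (\<integral>x. f x * \<phi> j x \<partial>cube_measure) \<le> \<eta> j"
    using f by (auto simp: constrained_fns_def)
  have h': "1-lipschitz_on {0..1} (\<lambda>t. - h t)"
    using h(1) by (auto simp: lipschitz_on_def dist_real_def)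
  define p where "p = (\<lambda>x. f x + h (f x))"
  define q where "q = (\<lambda>x. f x - h (f x))"
  have mp: "p \<in> monotone_fns" and mq: "q \<in> monotone_fns"
    using monotone_fns_perturb[OF mf h] monotone_fns_perturb[OF mf h'] h(2,3)
    by (simp_all add: p_def q_def)
  note int = monotone_fns_integrable[OF mf] monotone_fns_integrable[OF mp]
    monotone_fns_integrable[OF mq]
  \<comment> \<open>As a difference of two monotone functions, the perturbation inherits
    integrability.\<close>
  have hf: "(\<lambda>x. h (f x)) = (\<lambda>x. p x - f x)" by (auto simp: p_def)
  have int_h: "integrable cube_measure (\<lambda>x. h (f x))"
    unfolding hf using int by simp
  have "(\<integral>x. p x * \<phi> j x \<partial>cube_measure) \<le> \<eta> j \<and> (\<integral>x. q x * \<phi> j x \<partial>cube_measure) \<le> \<eta> j"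
    if j: "j \<in> {1..m}" for j
    using cf[OF j] orth[OF j] integrable_mult_ess_bounded[OF int(1) \<phi>[OF j]]
      integrable_mult_ess_bounded[OF int_h \<phi>[OF j]]
    by (simp add: p_def q_def algebra_simps)
  then have pq: "p \<in> constrained_fns m \<phi> \<eta>" "q \<in> constrained_fns m \<phi> \<eta>"
    using mp mq by (auto simp: constrained_fns_def)
  have ne: "L1_of p \<noteq> L1_of q"
    using nz by (simp add: L1_of_eq_iff[OF int(2,3)]) (simp add: p_def q_def)
  have "midpoint (L1_of p) (L1_of q) = L1_of (\<lambda>x. inverse 2 * (p x + q x))"
    using int by (simp add: midpoint_def plus_cube_L1.abs_eq scaleR_cube_L1.abs_eq L1_eq_def)
  also have "(\<lambda>x. inverse 2 * (p x + q x)) = f" by (auto simp: p_def q_def)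
  finally have "L1_of f \<in> open_segment (L1_of p) (L1_of q)"
    using midpoint_in_open_segment[of "L1_of p" "L1_of q"] ne by simp
  with ext pq show False unfolding extreme_point_of_def by blast
qed

section \<open>Tent functions with separated centres\<close>

lemma finite_separation:
  fixes T :: "real set"
  assumes "finite T"
  obtains d where "d > 0" "\<And>s t. s \<in> T \<Longrightarrow> t \<in> T \<Longrightarrow> s \<noteq> t \<Longrightarrow> d \<le> \<bar>s - t\<bar>"
proof -
  \<comment> \<open>The extra 1 keeps the set nonempty, so \<open>Min\<close> is meaningful when
    \<open>T\<close> has at most one point.\<close>
  let ?D = "insert 1 ((\<lambda>(s, t). \<bar>s - t\<bar>) ` {(s, t). s \<in> T \<and> t \<in> T \<and> s \<noteq> t})"
  have "finite {(s, t). s \<in> T \<and> t \<in> T \<and> s \<noteq> t}"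
    by (rule finite_subset[of _ "T \<times> T"]) (use assms in auto)
  then have fin: "finite ?D" by simp
  have "Min ?D > 0" using fin by (subst Min_gr_iff) auto
  moreover have "Min ?D \<le> \<bar>s - t\<bar>" if "s \<in> T" "t \<in> T" "s \<noteq> t" for s t
    using fin that by (intro Min_le) auto
  ultimately show ?thesis using that by blast
qed

text \<open>For \<open>d > 0\<close>, the hat function centred at \<open>t\<close> whose height
  equals its half-width \<open>d\<close>, so that its slopes are 1 and -1.\<close>

definition tent :: "real \<Rightarrow> real \<Rightarrow> real \<Rightarrow> real" where
  "tent d t v = max 0 (d - \<bar>v - t\<bar>)"

lemma tent_lipschitz: "\<bar>tent d t u - tent d t v\<bar> \<le> \<bar>u - v\<bar>"
  by (auto simp: tent_def max_def)

text \<open>Each tent is 1-Lipschitz. The constant is crude, but it can be normalized to 1 by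
  rescaling the coefficients.\<close>

lemma sum_tent_lipschitz:
  "(\<Sum>t\<in>T. \<bar>c t\<bar>)-lipschitz_on X (\<lambda>v. \<Sum>t\<in>T. c t * tent d t v)"
proof (rule lipschitz_onI)
  fix u v
  have "\<bar>(\<Sum>t\<in>T. c t * tent d t u) - (\<Sum>t\<in>T. c t * tent d t v)\<bar>
      = \<bar>\<Sum>t\<in>T. c t * (tent d t u - tent d t v)\<bar>"
    by (simp add: sum_subtractf right_diff_distrib)
  also have "\<dots> \<le> (\<Sum>t\<in>T. \<bar>c t\<bar> * \<bar>u - v\<bar>)"
    by (rule order_trans[OF sum_abs], rule sum_mono)
      (auto simp: abs_mult intro!: mult_left_mono tent_lipschitz)
  finally show "dist (\<Sum>t\<in>T. c t * tent d t u) (\<Sum>t\<in>T. c t * tent d t v)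
      \<le> (\<Sum>t\<in>T. \<bar>c t\<bar>) * dist u v"
    by (simp add: dist_real_def sum_distrib_right)
qed (simp add: sum_nonneg)

text \<open>With centres at least \<open>2 * d\<close> apart, every other tent vanishes within
  distance \<open>d\<close> of \<open>s\<close>.\<close>

lemma sum_tent_at:
  assumes "finite T" "s \<in> T" "\<bar>v - s\<bar> < d"
    and "\<And>t. t \<in> T \<Longrightarrow> t \<noteq> s \<Longrightarrow> 2 * d \<le> \<bar>t - s\<bar>"
  shows "(\<Sum>t\<in>T. c t * tent d t v) = c s * (d - \<bar>v - s\<bar>)"
proof -
  have "c t * tent d t v = 0" if "t \<in> T - {s}" for t
    using assms(3) assms(4)[of t] that by (auto simp: tent_def max_def)
  then have "(\<Sum>t\<in>T - {s}. c t * tent d t v) = 0"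
    by (rule sum.neutral[OF ballI])
  then have "(\<Sum>t\<in>T. c t * tent d t v) = c s * tent d s v"
    by (simp add: sum.remove[OF assms(1,2)])
  then show ?thesis using assms(3) by (simp add: tent_def)
qed

section \<open>Counting the intermediate essential values\<close>

text \<open>\<open>ess\<close> places \<open>T\<close> in the support of the distribution of
  \<open>f\<close>. With more than \<open>m\<close> tents, some nontrivial combination meets all
  \<open>m\<close> orthogonality conditions.\<close>

lemma extreme_point_essential_values:
  fixes f :: "real^'n \<Rightarrow> real"
  assumes \<phi>: "\<And>j. j \<in> {1..m} \<Longrightarrow> ess_bounded (\<phi> j)"
    and f: "f \<in> constrained_fns m \<phi> \<eta>"
    and ext: "L1_of f extreme_point_of (L1_of ` constrained_fns m \<phi> \<eta>)"
    and T: "finite T" "T \<subseteq> {0<..<1}"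
    and ess: "\<And>t U. t \<in> T \<Longrightarrow> open U \<Longrightarrow> t \<in> U \<Longrightarrow> \<not> (AE x in cube_measure. f x \<notin> U)"
  shows "card T \<le> m"
proof (rule ccontr)
  assume "\<not> card T \<le> m"
  then have card: "card {1..m} < card T" by simp
  have int_f: "integrable cube_measure f"
    using f by (auto simp: constrained_fns_def intro: monotone_fns_integrable)
  then have [measurable]: "f \<in> borel_measurable cube_measure" by simp
  \<comment> \<open>Including 0 and 1 makes the tents vanish at both ends; halving \<open>e\<close>
    keeps their open supports disjoint.\<close>
  obtain e where e: "e > 0"
    "\<And>s t. s \<in> insert 0 (insert 1 T) \<Longrightarrow> t \<in> insert 0 (insert 1 T) \<Longrightarrow> s \<noteq> t \<Longrightarrow> e \<le> \<bar>s - t\<bar>"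
    using finite_separation[of "insert 0 (insert 1 T)"] T(1) by auto
  define d where "d = e / 2"
  have d: "d > 0" "\<And>s t. s \<in> T \<Longrightarrow> t \<in> T \<Longrightarrow> t \<noteq> s \<Longrightarrow> 2 * d \<le> \<bar>t - s\<bar>"
    using e by (auto simp: d_def)
  have ends: "tent d t 0 = 0" "tent d t 1 = 0" if "t \<in> T" for t
    using e(1) e(2)[of 0 t] e(2)[of 1 t] that T(2) by (force simp: tent_def d_def)+
  obtain c where c: "\<exists>t\<in>T. c t \<noteq> 0"
    and c0: "\<And>j. j \<in> {1..m} \<Longrightarrow>
      (\<Sum>t\<in>T. c t * (\<integral>x. tent d t (f x) * \<phi> j x \<partial>cube_measure)) = 0"
    using underdetermined_system_nontrivial_solution[OF _ T(1) card,
      of "\<lambda>j t. \<integral>x. tent d t (f x) * \<phi> j x \<partial>cube_measure"]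
    by blast
  from c obtain s where s: "s \<in> T" "c s \<noteq> 0" by blast
  \<comment> \<open>Division by \<open>L\<close> brings the Lipschitz constant down to 1 while
    preserving the orthogonality relations.\<close>
  define L where "L = (\<Sum>t\<in>T. \<bar>c t\<bar>)"
  have L: "L > 0"
    unfolding L_def using s T(1) by (intro sum_pos2[of T s]) auto
  define h where "h = (\<lambda>v. \<Sum>t\<in>T. c t / L * tent d t v)"
  have "(\<Sum>t\<in>T. \<bar>c t / L\<bar>) = 1"
    using L by (simp add: abs_divide flip: sum_divide_distrib) (simp add: L_def)
  then have lip: "1-lipschitz_on {0..1} h"
    using sum_tent_lipschitz[of "\<lambda>t. c t / L" T] by (simp add: h_def)
  have h01: "h 0 = 0" "h 1 = 0"
    unfolding h_def using ends by (simp_all add: sum.neutral)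
  have int_t: "integrable cube_measure (\<lambda>x. tent d t (f x))" for t
  proof (rule Bochner_Integration.integrable_bound)
    have "finite_measure (cube_measure :: (real^'n) measure)"
      by (intro finite_measureI) (simp add: emeasure_restrict_space interval_cbox emeasure_lborel_cbox_eq)
    then show "integrable (cube_measure :: (real^'n) measure) (\<lambda>_. d)"
      by (rule finite_measure.integrable_const)
    show "AE x in cube_measure. norm (tent d t (f x)) \<le> norm d"
      using d(1) by (intro AE_I2) (auto simp: tent_def)
    show "(\<lambda>x. tent d t (f x)) \<in> borel_measurable cube_measure"
      unfolding tent_def by measurable
  qed
  have "(\<integral>x. h (f x) * \<phi> j x \<partial>cube_measure) = 0" if j: "j \<in> {1..m}" for j
  proof -
    have "(\<integral>x. h (f x) * \<phi> j x \<partial>cube_measure)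
        = (\<integral>x. (\<Sum>t\<in>T. c t / L * (tent d t (f x) * \<phi> j x)) \<partial>cube_measure)"
      by (simp add: h_def sum_distrib_right mult.assoc)
    also have "\<dots> = (\<Sum>t\<in>T. c t / L * (\<integral>x. tent d t (f x) * \<phi> j x \<partial>cube_measure))"
      by (subst Bochner_Integration.integral_sum)
        (auto intro!: integrable_mult_ess_bounded[OF int_t \<phi>[OF j]])
    also have "\<dots> = 0"
      using c0[OF j] by (simp flip: sum_divide_distrib)
    finally show ?thesis .
  qed
  from extreme_point_perturbation_trivial[OF \<phi> f ext lip h01 this]
  have "AE x in cube_measure. h (f x) = 0" by blast
  \<comment> \<open>On this ball \<open>h\<close> equals the single tent at \<open>s\<close> with a
    nonzero coefficient, hence has no zero there.\<close>
  then have "AE x in cube_measure. f x \<notin> ball s d"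
  proof eventually_elim
    case (elim x)
    show ?case
    proof
      assume "f x \<in> ball s d"
      then have near: "\<bar>f x - s\<bar> < d" by (simp add: dist_real_def abs_minus_commute)
      have "h (f x) = c s / L * (d - \<bar>f x - s\<bar>)"
        unfolding h_def by (rule sum_tent_at[OF T(1) s(1) near d(2)[OF s(1)]])
      with near s(2) L elim show False by simp
    qed
  qed
  with ess[OF s(1), of "ball s d"] d(1) show False by simp
qed

section \<open>Levels and the layer-cake sum\<close>

text \<open>Padding fixes the number of gaps at \<open>m + 1\<close> even if \<open>S\<close> is
  smaller; the surplus gaps have length 0 and later become zero weights.\<close>

lemma finite_set_covered_by_partition:
  fixes S :: "real set"
  assumes "finite S" "card S \<le> m" "S \<subseteq> {0<..<1}"
  obtains t :: "nat \<Rightarrow> real"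
  where "mono t" "t 0 = 0" "t (Suc m) = 1" "S \<union> {0, 1} \<subseteq> t ` {..Suc m}"
proof -
  define xs where "xs = sorted_list_of_set S"
  have xs: "set xs = S" "sorted xs" "length xs \<le> m"
    using assms by (auto simp: xs_def)
  \<comment> \<open>Index 0 holds the value 0, hence the shift \<open>i - 1\<close>; beyond the list
    the padding value is 1.\<close>
  define t where "t = (\<lambda>i. if i = 0 then 0 else if i \<le> length xs then xs ! (i - 1) else 1)"
  have nth: "xs ! i \<in> {0<..<1}" if "i < length xs" for i
    using that xs(1) assms(3) nth_mem by blast
  have "mono t"
  proof (rule monoI)
    fix i j :: nat assume ij: "i \<le> j"
    have "xs ! (i - 1) \<le> xs ! (j - 1)" if "j \<le> length xs" "0 < i"
      using xs(2) ij that by (intro sorted_nth_mono) auto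
    moreover have "0 < xs ! (k - 1)" "xs ! (k - 1) < 1" if "k \<le> length xs" "0 < k" for k
      using nth[of "k - 1"] that by auto
    ultimately show "t i \<le> t j" using ij by (force simp: t_def intro: less_imp_le)
  qed
  moreover have "t 0 = 0" "t (Suc m) = 1" using xs(3) by (auto simp: t_def)
  moreover have "S \<subseteq> t ` {..Suc m}"
  proof
    fix s assume "s \<in> S"
    then obtain i where "i < length xs" "xs ! i = s" using xs(1) by (auto simp: in_set_conv_nth)
    with xs(3) show "s \<in> t ` {..Suc m}"
      by (intro image_eqI[of _ _ "Suc i"]) (auto simp: t_def)
  qed
  ultimately show ?thesis using that by (metis Un_subset_iff atMost_iff empty_subsetI image_eqI
    insert_subset le0 le_refl)
qed

lemma layer_cake_partition:
  fixes t :: "nat \<Rightarrow> real"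
  assumes "mono t" "p \<le> n"
  shows "(\<Sum>i<n. (t (Suc i) - t i) * (if t (Suc i) \<le> t p then 1 else 0)) = t p - t 0"
proof -
  have "(\<Sum>i<n. (t (Suc i) - t i) * (if t (Suc i) \<le> t p then 1 else 0))
      = (\<Sum>i<p. t (Suc i) - t i)"
  proof (rule sum.mono_neutral_cong_right)
    \<comment> \<open>Levels may repeat: an index at or above \<open>p\<close> can pass the test,
      but only when its gap is 0.\<close>
    show "\<forall>i\<in>{..<n} - {..<p}. (t (Suc i) - t i) * (if t (Suc i) \<le> t p then 1 else 0) = 0"
    proof
      fix i assume "i \<in> {..<n} - {..<p}"
      then have "t p \<le> t i" "t i \<le> t (Suc i)" using assms(1) by (auto simp: mono_def)
      then show "(t (Suc i) - t i) * (if t (Suc i) \<le> t p then 1 else 0) = 0" by auto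
    qed
  qed (use assms in \<open>auto simp: mono_def Suc_le_eq\<close>)
  also have "\<dots> = t p - t 0" by (rule sum_lessThan_telescope)
  finally show ?thesis .
qed

section \<open>Extreme points as mixtures of nested up-sets\<close>

theorem theorem1:
  fixes \<phi> :: "nat \<Rightarrow> real^'n \<Rightarrow> real" and \<eta> :: "nat \<Rightarrow> real" and m :: nat
    and u :: "'n cube_L1"
  assumes "\<And>j. j \<in> {1..m} \<Longrightarrow> ess_bounded (\<phi> j)"
    and "u extreme_point_of (L1_of ` constrained_fns m \<phi> \<eta>)"
  shows "\<exists>(A :: nat \<Rightarrow> (real^'n) set) (w :: nat \<Rightarrow> real).
    (\<forall>j\<in>{1..m+1}. up_set (A j)) \<and>
    (\<forall>j\<in>{1..m+1}. \<forall>j'\<in>{1..m+1}. j < j' \<longrightarrow> A j \<subseteq> A j') \<and>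
    (\<forall>j\<in>{1..m+1}. 0 \<le> w j) \<and> (\<Sum>j=1..m+1. w j) = 1 \<and>
    u = (\<Sum>j=1..m+1. w j *\<^sub>R L1_of (indicat_real (A j)))"
proof -
  obtain f where f: "f \<in> constrained_fns m \<phi> \<eta>" and u: "u = L1_of f"
    using assms(2) by (auto simp: extreme_point_of_def)
  have ext: "L1_of f extreme_point_of (L1_of ` constrained_fns m \<phi> \<eta>)"
    using assms(2) u by simp
  have mf: "f \<in> monotone_fns" using f by (simp add: constrained_fns_def)
  \<comment> \<open>The complement of \<open>\<Union>N\<close> is the essential range of
    \<open>f\<close>; \<open>S\<close> is its part strictly between 0 and 1.\<close>
  define N where "N = {U. open U \<and> (AE x in cube_measure. f x \<notin> U)}"
  define S where "S = {0<..<1} - \<Union>N"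
  have card_le: "card T \<le> m" if "finite T" "T \<subseteq> S" for T
    by (rule extreme_point_essential_values[OF assms(1) f ext that(1)])
      (use that(2) in \<open>auto simp: S_def N_def\<close>)
  have S: "finite S" "card S \<le> m"
  proof -
    \<comment> \<open>An infinite \<open>S\<close> would contain a finite subset with
      \<open>m + 1\<close> elements.\<close>
    show "finite S"
      using card_le infinite_arbitrarily_large[of S "Suc m"] by (metis not_less_eq_eq order_refl)
    then show "card S \<le> m" using card_le by blast
  qed
  \<comment> \<open>\<open>N\<close> may be uncountable; a countable subfamily with the same union
    allows the null sets to be combined.\<close>
  obtain N' where N': "N' \<subseteq> N" "countable N'" "\<Union>N' = \<Union>N"
    using Lindelof[of N] by (auto simp: N_def)
  have "AE x in cube_measure. \<forall>U\<in>N'. f x \<notin> U"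
    using N' by (subst AE_ball_countable) (auto simp: N_def)
  moreover have "AE x in cube_measure. f x \<in> {0..1}"
    using mf by (intro AE_I2) (auto simp: monotone_fns_def)
  ultimately have AE_values: "AE x in cube_measure. f x \<in> S \<union> {0, 1}"
  proof eventually_elim
    case (elim x)
    then have "f x \<notin> \<Union>N" using N'(3) by blast
    with elim show ?case by (auto simp: S_def)
  qed
  have "S \<subseteq> {0<..<1}" by (auto simp: S_def)
  with S obtain t where t: "mono t" "t 0 = 0" "t (Suc m) = 1"
    "S \<union> {0, 1} \<subseteq> t ` {..Suc m}"
    by (rule finite_set_covered_by_partition)
  \<comment> \<open>The levels are indexed downwards so that the superlevel sets increase.\<close>
  define A where "A = (\<lambda>j. {x\<in>{0..1}. t (Suc (m + 1 - j)) \<le> f x})"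
  define w where "w = (\<lambda>j. t (Suc (m + 1 - j)) - t (m + 1 - j))"
  have reindex: "(\<Sum>j=1..m+1. g (m + 1 - j)) = (\<Sum>i<Suc m. g i)" for g :: "nat \<Rightarrow> real"
    by (rule sum.reindex_bij_witness[of _ "\<lambda>i. m + 1 - i" "\<lambda>j. m + 1 - j"]) auto
  have up: "up_set (A j)" for j
    using mf by (auto simp: up_set_def A_def monotone_fns_def mono_on_def intro: order_trans)
  \<comment> \<open>Truncated subtraction keeps \<open>m + 1 - j\<close> antitone for all
    \<open>j\<close>, so no range restriction appears here.\<close>
  have nested: "A j \<subseteq> A j'" if "j < j'" for j j'
  proof -
    have "t (Suc (m + 1 - j')) \<le> t (Suc (m + 1 - j))"
      using that by (intro monoD[OF t(1)]) auto
    then show ?thesis by (auto simp: A_def)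
  qed
  have w_nonneg: "0 \<le> w j" for j
    using t(1) by (auto simp: w_def mono_def)
  have w_sum: "(\<Sum>j=1..m+1. w j) = 1"
    unfolding w_def reindex[of "\<lambda>i. t (Suc i) - t i"] sum_lessThan_telescope using t by simp
  note int_A = monotone_fns_integrable[OF up_set_indicator_monotone[OF up]]
  have "AE x in cube_measure. f x = (\<Sum>j=1..m+1. w j * indicat_real (A j) x)"
    \<comment> \<open>\<open>AE_space\<close> puts \<open>x\<close> in the cube, so membership in
      \<open>A j\<close> reduces to comparing levels.\<close>
    using AE_values AE_space
  proof eventually_elim
    case (elim x)
    then obtain p where p: "p \<le> Suc m" "f x = t p" using t(4) by blast
    have "(\<Sum>j=1..m+1. w j * indicat_real (A j) x)
        = (\<Sum>i<Suc m. (t (Suc i) - t i) * (if t (Suc i) \<le> t p then 1 else 0))"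
      unfolding reindex[of "\<lambda>i. (t (Suc i) - t i) * (if t (Suc i) \<le> t p then 1 else 0)", symmetric]
      using elim p by (intro sum.cong) (auto simp: w_def A_def indicator_def space_restrict_space)
    also have "\<dots> = f x" using layer_cake_partition[OF t(1) p(1)] p(2) t(2) by simp
    finally show ?case by simp
  qed
  moreover have "integrable cube_measure (\<lambda>x. \<Sum>j=1..m+1. w j * indicat_real (A j) x)"
    using int_A by (intro Bochner_Integration.integrable_sum integrable_mult_right)
  ultimately have "u = L1_of (\<lambda>x. \<Sum>j=1..m+1. w j * indicat_real (A j) x)"
    unfolding u by (subst L1_of_eq_iff[OF monotone_fns_integrable[OF mf]])
  also have "\<dots> = (\<Sum>j=1..m+1. w j *\<^sub>R L1_of (indicat_real (A j)))"
    using int_A by (intro L1_of_sum[symmetric]) auto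
  finally show ?thesis using up nested w_nonneg w_sum by blast
qed

end
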